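(* Let $\mu = \sum_{i=1}^\infty a_i \delta_{r_i}$ be a (potentially signed) measure, where $a = (a_i)_{i=1}^\infty$ is a real sequence in $\ell^1$ with $a_1 > 0$, and $(r_i)_{i=1}^\infty$ is a strictly decreasing sequence of positive numbers. Suppose as well that $\sum_{i=1}^\infty a_i = 1$. Let $\gamma = (\gamma_n)_{n=0}^\infty$ be the moment sequence of $\mu$, $\gamma_n = \int_{\mathbb{R}_+} t^n\, d\mu(t)$, assumed to satisfy $\gamma_n > 0$ for all $n$, and let $W_\alpha$ be the weighted shift with weights $\alpha_n = \sqrt{\gamma_{n+1}/\gamma_n}$. Let $k \in \{1,2,\ldots\}$. Then the restriction of $W_\alpha$ to some canonical invariant subspace $\bigvee\{e_i : i \ge I\}$ is $k$-hyponormal if and only if the first $k+1$ non-zero $a_i$ are strictly positive (meaning all non-zero $a_i$, if there are fewer than $k+1$ of them).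
   Context: $\delta_r$ is the Dirac measure at $r$ and $\mathbb{R}_+ = [0,\infty)$. For a positive weight sequence $\alpha$, the weighted shift $W_\alpha$ acts on $\ell^2$ with standard basis $\{e_j\}_{j\ge0}$ by $W_\alpha e_j = \alpha_j e_{j+1}$; its moments are $\gamma_0 = 1$ and $\gamma_j = \prod_{i=0}^{j-1}\alpha_i^2$ for $j\ge1$. A weighted shift with moments $(\gamma_n)$ is $k$-hyponormal if and only if, for every $m = 0,1,2,\ldots$, the $(k+1)\times(k+1)$ Hankel matrix $(\gamma_{m+i+j})_{i,j=0}^{k}$ is positive semi-definite. The restriction of $W_\alpha$ to $\bigvee\{e_i : i\ge I\}$ (closed linear span) is the weighted shift with weights $\alpha_I,\alpha_{I+1},\ldots$. *)

theory Defs
  imports "HOL-Analysis.Analysis"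
begin

section \<open>Signed atomic measures and their moments\<close>

text \<open>
  The positive part of the signed measure with mass \<open>a i\<close> at \<open>r i\<close>, for \<open>r\<close> injective: \<open>ennreal\<close>
  truncates negative reals to \<open>0\<close>, so the atom at \<open>r i\<close> gets the mass \<open>max 0 (a i)\<close>.
  Negating \<open>a\<close> gives the negative part.
\<close>

definition atomic_pos_part :: "(nat \<Rightarrow> real) \<Rightarrow> (nat \<Rightarrow> real) \<Rightarrow> real measure" where
  "atomic_pos_part a r = distr (density (count_space UNIV) (\<lambda>i. ennreal (a i))) borel r"

definition atomic_neg_part :: "(nat \<Rightarrow> real) \<Rightarrow> (nat \<Rightarrow> real) \<Rightarrow> real measure" where
  "atomic_neg_part a r = atomic_pos_part (\<lambda>i. - a i) r"

text \<open>
  Integration over \<open>[0,\<infinity>)\<close> against a signed measure is the difference of the integrals against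
  its positive and negative parts.
\<close>

definition signed_atomic_moment :: "(nat \<Rightarrow> real) \<Rightarrow> (nat \<Rightarrow> real) \<Rightarrow> nat \<Rightarrow> real" where
  "signed_atomic_moment a r n =
     (LINT t:{0..}|atomic_pos_part a r. t ^ n) - (LINT t:{0..}|atomic_neg_part a r. t ^ n)"

section \<open>The complex Hilbert space of square-summable sequences\<close>

definition l2 :: "(nat \<Rightarrow> complex) set" where
  "l2 = {x. summable (\<lambda>n. (cmod (x n))\<^sup>2)}"

definition l2_inner :: "(nat \<Rightarrow> complex) \<Rightarrow> (nat \<Rightarrow> complex) \<Rightarrow> complex" where
  "l2_inner x y = (\<Sum>n. x n * cnj (y n))"

definition l2_norm :: "(nat \<Rightarrow> complex) \<Rightarrow> real" where
  "l2_norm x = sqrt (\<Sum>n. (cmod (x n))\<^sup>2)"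

definition l2_basis :: "nat \<Rightarrow> nat \<Rightarrow> complex" where
  "l2_basis j = (\<lambda>n. if n = j then 1 else 0)"

text \<open>The closed linear span of the basis vectors with index at least \<open>I\<close>.\<close>

definition canonical_subspace :: "nat \<Rightarrow> (nat \<Rightarrow> complex) set" where
  "canonical_subspace I = {x \<in> l2. \<forall>\<epsilon>>0. \<exists>F c. finite F \<and> F \<subseteq> {I..} \<and>
     l2_norm (\<lambda>n. x n - (\<Sum>i\<in>F. c i * l2_basis i n)) < \<epsilon>}"

section \<open>Weighted shifts and k-hyponormality\<close>

definition weighted_shift :: "(nat \<Rightarrow> real) \<Rightarrow> (nat \<Rightarrow> complex) \<Rightarrow> nat \<Rightarrow> complex" where
  "weighted_shift \<alpha> x = (\<lambda>n. case n of 0 \<Rightarrow> 0 | Suc m \<Rightarrow> complex_of_real (\<alpha> m) * x m)"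

text \<open>
  \<open>S\<close> is the adjoint of the restriction of \<open>T\<close> to the closed subspace \<open>M\<close>, both being operators
  from \<open>M\<close> to itself. The existence of such an \<open>S\<close> forces \<open>T\<close> to be linear on \<open>M\<close>, hence bounded
  by the Hellinger--Toeplitz argument, and \<open>S\<close> is unique on \<open>M\<close>.
\<close>

definition is_adjoint_on ::
  "(nat \<Rightarrow> complex) set \<Rightarrow> ((nat \<Rightarrow> complex) \<Rightarrow> nat \<Rightarrow> complex) \<Rightarrow>
   ((nat \<Rightarrow> complex) \<Rightarrow> nat \<Rightarrow> complex) \<Rightarrow> bool" where
  "is_adjoint_on M T S \<longleftrightarrow> T ` M \<subseteq> M \<and> S ` M \<subseteq> M \<and>
     (\<forall>x\<in>M. \<forall>y\<in>M. l2_inner (T x) y = l2_inner x (S y))"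

text \<open>
  The restriction of \<open>T\<close> to \<open>M\<close> is k-hyponormal if the \<open>(k+1) \<times> (k+1)\<close> operator matrix whose
  \<open>(i,j)\<close> entry is \<open>T\<^sup>*\<^sup>j T\<^sup>i\<close>, for \<open>i, j = 0, \<dots>, k\<close>, is a positive operator on the direct sum of
  \<open>k+1\<close> copies of \<open>M\<close>; here \<open>x j\<close> is the \<open>j\<close>-th component of a vector of that direct sum.
  For \<open>k = 1\<close> this is ordinary hyponormality \<open>T\<^sup>*T \<ge> TT\<^sup>*\<close>.
\<close>

definition k_hyponormal_on ::
  "nat \<Rightarrow> (nat \<Rightarrow> complex) set \<Rightarrow> ((nat \<Rightarrow> complex) \<Rightarrow> nat \<Rightarrow> complex) \<Rightarrow> bool" where
  "k_hyponormal_on k M T \<longleftrightarrow> (\<exists>S. is_adjoint_on M T S \<and>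
     (\<forall>x :: nat \<Rightarrow> nat \<Rightarrow> complex. (\<forall>j\<le>k. x j \<in> M) \<longrightarrow>
        (\<Sum>i\<le>k. \<Sum>j\<le>k. l2_inner ((S ^^ j) ((T ^^ i) (x j))) (x i)) \<in> \<real>\<^sub>\<ge>\<^sub>0))"

end

theory Submission
  imports Defs
begin

text \<open>
  A Hankel form of the moments at the coefficient vector of a polynomial \<open>p\<close> of degree at most \<open>k\<close>
  equals \<open>\<Sum>l. a l * r l ^ m * \<bar>p (r l)\<bar>\<^sup>2\<close>, and for large \<open>m\<close> every atom dominates all the later
  ones geometrically. If the first \<open>k + 1\<close> non-zero masses are positive, Lagrange interpolation at
  their atoms bounds \<open>\<bar>p\<bar>\<^sup>2\<close> at all the other atoms, so the later atoms cannot destroy positivity.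
  If instead a negative mass is preceded by at most \<open>k\<close> non-zero ones, the polynomial vanishing
  at those earlier atoms makes the negative mass dominate.
\<close>

section \<open>Square-summable sequences\<close>

lemma l2_summable_prod:
  assumes "x \<in> l2" "y \<in> l2"
  shows "summable (\<lambda>n. x n * cnj (y n))"
proof (rule summable_norm_cancel, rule summable_comparison_test)
  show "summable (\<lambda>n. (cmod (x n))\<^sup>2 + (cmod (y n))\<^sup>2)"
    using assms by (intro summable_add) (auto simp: l2_def)
  have "norm (norm (x n * cnj (y n))) \<le> (cmod (x n))\<^sup>2 + (cmod (y n))\<^sup>2" for n
  proof -
    have "2 * (cmod (x n) * cmod (y n)) \<le> (cmod (x n))\<^sup>2 + (cmod (y n))\<^sup>2"
      using sum_squares_bound[of "cmod (x n)" "cmod (y n)"] by (simp add: mult.assoc)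
    moreover have "0 \<le> cmod (x n) * cmod (y n)" by simp
    ultimately have "cmod (x n) * cmod (y n) \<le> (cmod (x n))\<^sup>2 + (cmod (y n))\<^sup>2"
      by linarith
    then show ?thesis by (simp add: norm_mult)
  qed
  then show "\<exists>N. \<forall>n\<ge>N. norm (norm (x n * cnj (y n))) \<le> (cmod (x n))\<^sup>2 + (cmod (y n))\<^sup>2"
    by blast
qed

lemma l2_inner_commute:
  assumes "x \<in> l2" "y \<in> l2"
  shows "l2_inner y x = cnj (l2_inner x y)"
proof -
  have "(\<lambda>n. cnj (x n * cnj (y n))) sums cnj (l2_inner x y)"
    unfolding sums_cnj l2_inner_def using l2_summable_prod[OF assms] by (rule summable_sums)
  then show ?thesis
    by (simp add: l2_inner_def mult.commute sums_iff)
qed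

text \<open>A combination of basis vectors with index at least \<open>I\<close> leaves the
  coordinates below \<open>I\<close> untouched, so each of them is bounded by every approximation
  error and must vanish. Conversely, the truncations of a square-summable sequence approximate it in
  norm.\<close>

lemma canonical_subspace_eq: "canonical_subspace I = {x \<in> l2. \<forall>n<I. x n = 0}"
proof (intro set_eqI iffI)
  fix x assume x: "x \<in> canonical_subspace I"
  then have l2: "x \<in> l2" by (simp add: canonical_subspace_def)
  have "x n = 0" if n: "n < I" for n
  proof (rule ccontr)
    assume "x n \<noteq> 0"
    then have "cmod (x n) > 0" by simp
    then obtain F c where F: "finite F" "F \<subseteq> {I..}"
      and less: "l2_norm (\<lambda>n. x n - (\<Sum>i\<in>F. c i * l2_basis i n)) < cmod (x n)"
      using x unfolding canonical_subspace_def by blast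
    define y where "y = (\<lambda>n. x n - (\<Sum>i\<in>F. c i * l2_basis i n))"
    have y_eq: "y m = x m" if "m \<notin> F" for m
      using that unfolding y_def by (auto simp: l2_basis_def intro!: sum.neutral)
    \<comment> \<open>Only finitely many coordinates differ, so \<open>y\<close> stays
      square-summable; this makes its norm a genuine upper bound for a single coordinate.\<close>
    have "eventually (\<lambda>m. (cmod (y m))\<^sup>2 = (cmod (x m))\<^sup>2) sequentially"
    proof -
      obtain N where "\<forall>m\<in>F. m < N" using F(1) finite_nat_set_iff_bounded by blast
      then have "\<And>m. m \<ge> N \<Longrightarrow> m \<notin> F" by fastforce
      then show ?thesis using y_eq unfolding eventually_sequentially by metis
    qed
    from summable_cong[OF this] have sy: "summable (\<lambda>m. (cmod (y m))\<^sup>2)"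
      using l2 by (simp add: l2_def)
    have "(cmod (x n))\<^sup>2 = (\<Sum>m\<in>{n}. (cmod (y m))\<^sup>2)"
    proof -
      have "n \<notin> F" using F(2) n by auto
      then show ?thesis by (simp add: y_eq)
    qed
    also have "\<dots> \<le> (\<Sum>m. (cmod (y m))\<^sup>2)"
      by (rule sum_le_suminf[OF sy]) auto
    finally have "cmod (x n) \<le> l2_norm y"
      unfolding l2_norm_def by (simp add: real_le_rsqrt)
    then show False using less by (simp add: y_def)
  qed
  then show "x \<in> {x \<in> l2. \<forall>n<I. x n = 0}" using l2 by simp
next
  fix x assume "x \<in> {x \<in> l2. \<forall>n<I. x n = 0}"
  then have x: "x \<in> l2" and zero: "\<And>n. n < I \<Longrightarrow> x n = 0" by auto
  have sx: "summable (\<lambda>n. (cmod (x n))\<^sup>2)" using x by (simp add: l2_def)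
  have "\<exists>F c. finite F \<and> F \<subseteq> {I..} \<and>
     l2_norm (\<lambda>n. x n - (\<Sum>i\<in>F. c i * l2_basis i n)) < \<epsilon>" if "\<epsilon> > 0" for \<epsilon>
  proof -
    obtain N where N: "\<And>n. n \<ge> N \<Longrightarrow> norm (\<Sum>i. (cmod (x (i + n)))\<^sup>2) < \<epsilon>\<^sup>2"
      using suminf_exist_split[OF _ sx, of "\<epsilon>\<^sup>2"] \<open>\<epsilon> > 0\<close> by auto
    have eq: "(\<Sum>i\<in>{I..<N}. x i * l2_basis i n) = (if n < N then x n else 0)" for n
      using zero by (auto simp: l2_basis_def if_distrib[of "(*) _"] sum.delta' cong: if_cong)
    have "(\<lambda>n. (cmod (if n < N then 0 else x n))\<^sup>2) sums (\<Sum>i. (cmod (x (i + N)))\<^sup>2)"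
    proof (subst sums_zero_iff_shift[symmetric, of N])
      show "(\<lambda>i. (cmod (if i + N < N then 0 else x (i + N)))\<^sup>2) sums (\<Sum>i. (cmod (x (i + N)))\<^sup>2)"
        using sx by (simp add: summable_sums summable_iff_shift[of "\<lambda>n. (cmod (x n))\<^sup>2"])
    qed simp
    then have "l2_norm (\<lambda>n. if n < N then 0 else x n) = sqrt (\<Sum>i. (cmod (x (i + N)))\<^sup>2)"
      by (simp add: l2_norm_def sums_iff)
    also have "\<dots> < \<epsilon>"
      using N[of N] \<open>\<epsilon> > 0\<close> by (intro real_less_lsqrt) auto
    also have "(\<lambda>n. if n < N then 0 else x n) = (\<lambda>n. x n - (\<Sum>i\<in>{I..<N}. x i * l2_basis i n))"
      by (auto simp: eq)
    finally show ?thesis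
      by (intro exI[of _ "{I..<N}"] exI[of _ x]) auto
  qed
  then show "x \<in> canonical_subspace I"
    using x unfolding canonical_subspace_def by blast
qed

section \<open>The Hankel criterion for weighted shifts\<close>

text \<open>The quadratic form of the Hankel matrix that starts at index \<open>m\<close>; positive
  semi-definiteness means that it lies in \<open>\<real>\<^sub>\<ge>\<^sub>0\<close> for every
  \<open>z\<close>.\<close>

definition hankel_form :: "(nat \<Rightarrow> real) \<Rightarrow> nat \<Rightarrow> nat \<Rightarrow> (nat \<Rightarrow> complex) \<Rightarrow> complex" where
  "hankel_form \<gamma> k m z = (\<Sum>i\<le>k. \<Sum>j\<le>k. of_real (\<gamma> (m + i + j)) * z j * cnj (z i))"

text \<open>The form sees only \<open>z 0\<close>, ..., \<open>z k\<close>, so test vectors may be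
  taken to be coefficient vectors of polynomials, which can then be evaluated at the atoms.\<close>

lemma hankel_form_eq_coeff:
  obtains p where "degree p \<le> k" "hankel_form \<gamma> k m z = hankel_form \<gamma> k m (coeff p)"
proof
  define p where "p = (\<Sum>j\<le>k. monom (z j) j)"
  show "degree p \<le> k"
    unfolding p_def by (intro degree_sum_le) (auto intro: order.trans[OF degree_monom_le])
  have "coeff p i = z i" if "i \<le> k" for i
    using that by (simp add: p_def coeff_sum)
  then show "hankel_form \<gamma> k m z = hankel_form \<gamma> k m (coeff p)"
    by (simp add: hankel_form_def)
qed

text \<open>Dropping the leading zeros of \<open>z\<close> moves the remaining indices down by
  \<open>s\<close>. The truncated differences \<open>i - s\<close> for \<open>i < s\<close> do no
  harm, since \<open>z i = 0\<close> there. Needed for blocks cut off by the boundary of the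
  subspace.\<close>

lemma hankel_form_shift:
  assumes "\<And>i. i < s \<Longrightarrow> z i = 0"
  shows "(\<Sum>i\<le>k. \<Sum>j\<le>k. of_real (\<gamma> (m + (i - s) + (j - s))) * z j * cnj (z i)) =
    hankel_form \<gamma> k m (\<lambda>i. if i + s \<le> k then z (i + s) else 0)"
proof -
  have shift: "(\<Sum>i\<le>k. h i) = (\<Sum>i\<le>k. if i + s \<le> k then h (i + s) else 0)"
    if "\<And>i. i < s \<Longrightarrow> h i = 0" for h :: "nat \<Rightarrow> complex"
  proof (cases "s \<le> k")
    case True
    have "(\<Sum>i\<le>k. h i) = (\<Sum>i\<in>{0+s..(k-s)+s}. h i)"
      using that True by (intro sum.mono_neutral_right) auto
    also have "\<dots> = (\<Sum>i\<in>{0..k-s}. h (i + s))"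
      by (rule sum.shift_bounds_cl_nat_ivl)
    also have "\<dots> = (\<Sum>i\<le>k. if i + s \<le> k then h (i + s) else 0)"
      using True by (intro sum.mono_neutral_cong_left) auto
    finally show ?thesis .
  next
    case False
    then show ?thesis using that by (simp add: sum.neutral)
  qed
  show ?thesis
    unfolding hankel_form_def using assms
    by (subst shift, simp, intro sum.cong refl, simp, subst shift, simp)
       (auto intro!: sum.cong)
qed

section \<open>From k-hyponormality to Hankel matrices\<close>

locale moment_shift =
  fixes \<gamma> \<alpha> :: "nat \<Rightarrow> real"
  assumes \<gamma>_pos: "\<gamma> n > 0"
    and \<alpha>_eq: "\<alpha> n = sqrt (\<gamma> (Suc n) / \<gamma> n)"
begin

abbreviation T :: "(nat \<Rightarrow> complex) \<Rightarrow> nat \<Rightarrow> complex" where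
  "T \<equiv> weighted_shift \<alpha>"

text \<open>The product of the \<open>i\<close> weights between coordinates \<open>p - i\<close> and
  \<open>p\<close> telescopes to a single quotient of moments.\<close>

lemma shift_power:
  "(T ^^ i) x p = (if p < i then 0 else of_real (sqrt (\<gamma> p / \<gamma> (p - i))) * x (p - i))"
proof (induction i arbitrary: p)
  case 0
  then show ?case using \<gamma>_pos[of p] by simp
next
  case (Suc i)
  show ?case
  proof (cases p)
    case 0
    then show ?thesis by (simp add: weighted_shift_def)
  next
    case (Suc q)
    have "sqrt (\<gamma> (Suc q) / \<gamma> q) * sqrt (\<gamma> q / \<gamma> (q - i)) = sqrt (\<gamma> (Suc q) / \<gamma> (q - i))"
      using \<gamma>_pos[of q] by (simp flip: real_sqrt_mult)
    then show ?thesis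
      using Suc Suc.IH[of q]
      by (simp add: weighted_shift_def \<alpha>_eq mult.assoc[symmetric] flip: of_real_mult)
  qed
qed

text \<open>Rewrites an entry of the operator matrix as the inner product of
  \<open>(T ^^ i) (x j)\<close> with \<open>(T ^^ j) (x i)\<close>, so that no formula for
  \<open>S\<close> is needed.\<close>

lemma adjoint_power:
  assumes adj: "is_adjoint_on M T S" and M: "M \<subseteq> l2" and "u \<in> M" "v \<in> M"
  shows "(T ^^ j) v \<in> M" "l2_inner ((S ^^ j) u) v = l2_inner u ((T ^^ j) v)"
proof -
  have TM: "T x \<in> M" and SM: "S x \<in> M" if "x \<in> M" for x
    using adj that by (auto simp: is_adjoint_on_def)
  have Sj: "(S ^^ j) u \<in> M" for j using SM \<open>u \<in> M\<close> by (induction j) auto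
  show "(T ^^ j) v \<in> M" using TM \<open>v \<in> M\<close> by (induction j) auto
  show "l2_inner ((S ^^ j) u) v = l2_inner u ((T ^^ j) v)" using \<open>v \<in> M\<close>
  proof (induction j arbitrary: v)
    case (Suc j)
    define w where "w = (S ^^ j) u"
    have w: "w \<in> M" using Sj by (simp add: w_def)
    \<comment> \<open>The adjoint relation moves \<open>T\<close> out of the first slot; conjugate
      symmetry on both sides lets it move \<open>S\<close> instead.\<close>
    have "l2_inner (S w) v = cnj (l2_inner v (S w))"
      using w SM Suc.prems M by (intro l2_inner_commute) auto
    also have "\<dots> = cnj (l2_inner (T v) w)"
      using adj w Suc.prems by (simp add: is_adjoint_on_def)
    also have "\<dots> = l2_inner w (T v)"
      using w TM Suc.prems M by (intro l2_inner_commute[symmetric]) auto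
    also have "\<dots> = l2_inner u ((T ^^ j) (T v))"
      unfolding w_def using Suc TM by blast
    finally show ?case by (simp add: w_def funpow_swap1)
  qed simp
qed

text \<open>Take for \<open>x i\<close> the multiple \<open>sqrt (\<gamma> (m + i)) * z i\<close> of
  the basis vector at \<open>m + i\<close>. Then \<open>(T ^^ i) (x j)\<close> sits at
  \<open>m + i + j\<close> with coefficient \<open>sqrt (\<gamma> (m + i + j)) * z j\<close>, so the
  entries of the operator form are exactly those of the Hankel form. The bound
  \<open>m \<ge> I\<close> keeps these vectors in the subspace.\<close>

lemma hankel_of_k_hyponormal:
  assumes "k_hyponormal_on k (canonical_subspace I) T" "m \<ge> I"
  shows "hankel_form \<gamma> k m z \<in> \<real>\<^sub>\<ge>\<^sub>0"
proof -
  let ?M = "canonical_subspace I"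
  obtain S where adj: "is_adjoint_on ?M T S"
    and pos: "\<And>x. (\<And>j. j \<le> k \<Longrightarrow> x j \<in> ?M) \<Longrightarrow>
      (\<Sum>i\<le>k. \<Sum>j\<le>k. l2_inner ((S ^^ j) ((T ^^ i) (x j))) (x i)) \<in> \<real>\<^sub>\<ge>\<^sub>0"
    using assms by (auto simp: k_hyponormal_on_def)
  have Ml2: "?M \<subseteq> l2" by (auto simp: canonical_subspace_eq)
  define x where "x = (\<lambda>i n. if n = m + i then of_real (sqrt (\<gamma> (m + i))) * z i else 0)"
  have xM: "x i \<in> ?M" for i
  proof -
    have "summable (\<lambda>n. (cmod (x i n))\<^sup>2)"
      by (rule summable_finite[of "{m + i}"]) (auto simp: x_def)
    then show ?thesis using \<open>m \<ge> I\<close> by (auto simp: canonical_subspace_eq l2_def x_def)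
  qed
  have Tx: "(T ^^ i) (x j) p = (if p = m + i + j then of_real (sqrt (\<gamma> p)) * z j else 0)" for i j p
  proof -
    have "sqrt (\<gamma> (m + i + j) / \<gamma> (m + j)) * sqrt (\<gamma> (m + j)) = sqrt (\<gamma> (m + i + j))"
      using \<gamma>_pos[of "m + j"] by (simp flip: real_sqrt_mult)
    then show ?thesis
      by (auto simp: shift_power x_def mult.assoc[symmetric] simp flip: of_real_mult)
  qed
  have "l2_inner ((S ^^ j) ((T ^^ i) (x j))) (x i) = of_real (\<gamma> (m + i + j)) * z j * cnj (z i)" for i j
  proof -
    let ?f = "\<lambda>n. (T ^^ i) (x j) n * cnj ((T ^^ j) (x i) n)"
    have "l2_inner ((S ^^ j) ((T ^^ i) (x j))) (x i) = l2_inner ((T ^^ i) (x j)) ((T ^^ j) (x i))"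
      using adjoint_power[OF adj Ml2] xM by blast
    also have "\<dots> = (\<Sum>n\<in>{m + i + j}. ?f n)"
      unfolding l2_inner_def by (rule suminf_finite) (auto simp: Tx)
    also have "\<dots> = (of_real (sqrt (\<gamma> (m + i + j))))\<^sup>2 * z j * cnj (z i)"
      by (simp add: Tx add_ac mult_ac power2_eq_square)
    also have "(of_real (sqrt (\<gamma> (m + i + j))))\<^sup>2 = complex_of_real (\<gamma> (m + i + j))"
      using \<gamma>_pos[of "m + i + j"] by (simp flip: of_real_power)
    finally show ?thesis .
  qed
  with pos[of x] xM show ?thesis by (simp add: hankel_form_def)
qed

end

section \<open>From Hankel matrices to k-hyponormality\<close>

lemma nonneg_Reals_suminf:
  assumes "summable f" "\<And>n. f n \<in> \<real>\<^sub>\<ge>\<^sub>0"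
  shows "suminf f \<in> (\<real>\<^sub>\<ge>\<^sub>0 :: complex set)"
proof -
  have "(\<lambda>n. Re (f n)) sums Re (suminf f)" "(\<lambda>n. Im (f n)) sums Im (suminf f)"
    using summable_sums[OF assms(1)] by (simp_all add: sums_complex_iff)
  moreover have "Re (f n) \<ge> 0" "Im (f n) = 0" for n
    using assms(2)[of n] by (auto simp: complex_nonneg_Reals_iff)
  ultimately have "Re (suminf f) \<ge> 0" "Im (suminf f) = 0"
    using suminf_nonneg[of "\<lambda>n. Re (f n)"] by (simp_all add: sums_iff)
  then show ?thesis by (simp add: complex_nonneg_Reals_iff)
qed

lemma l2_shift_down: "x \<in> l2 \<Longrightarrow> (\<lambda>n. x (Suc n)) \<in> l2"
  by (simp add: l2_def summable_Suc_iff[of "\<lambda>n. (cmod (x n))\<^sup>2"])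

lemma l2_mult_bounded:
  assumes "x \<in> l2" "\<And>n. \<bar>b n\<bar> \<le> C"
  shows "(\<lambda>n. of_real (b n) * x n) \<in> l2"
proof -
  have "summable (\<lambda>n. C\<^sup>2 * (cmod (x n))\<^sup>2)"
    using assms(1) by (intro summable_mult) (simp add: l2_def)
  moreover have "norm ((cmod (of_real (b n) * x n))\<^sup>2) \<le> C\<^sup>2 * (cmod (x n))\<^sup>2" for n
  proof -
    have "\<bar>b n\<bar>\<^sup>2 \<le> C\<^sup>2" using assms(2) by (intro power_mono) auto
    then show ?thesis by (simp add: norm_mult power_mult_distrib mult_right_mono)
  qed
  ultimately have "summable (\<lambda>n. (cmod (of_real (b n) * x n))\<^sup>2)"
    by (rule summable_comparison_test')
  then show ?thesis by (simp only: l2_def mem_Collect_eq)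
qed

lemma weighted_shift_l2:
  assumes "x \<in> l2" "\<And>n. \<bar>\<alpha> n\<bar> \<le> C"
  shows "weighted_shift \<alpha> x \<in> l2"
  using l2_mult_bounded[OF assms]
  by (subst l2_def, subst mem_Collect_eq, subst summable_Suc_iff[symmetric])
     (simp add: weighted_shift_def l2_def)

context moment_shift
begin

text \<open>The coordinate \<open>p\<close> of the entry \<open>(i, j)\<close> involves only
  \<open>x j\<close> at \<open>p - i\<close> and \<open>x i\<close> at \<open>p - j\<close>. Hence
  the operator form decouples into a series of finite blocks, each of them a Hankel form starting at
  or beyond \<open>I\<close>.\<close>

lemma k_hyponormal_of_hankel:
  assumes bounded: "\<And>n. \<bar>\<alpha> n\<bar> \<le> C"
    and psd: "\<And>m z. m \<ge> I \<Longrightarrow> hankel_form \<gamma> k m z \<in> \<real>\<^sub>\<ge>\<^sub>0"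
  shows "k_hyponormal_on k (canonical_subspace I) T"
proof -
  let ?M = "canonical_subspace I"
  \<comment> \<open>The weighted backward shift, cut off below \<open>I\<close> so that its values
    stay in the subspace.\<close>
  define S where "S = (\<lambda>y n. if n < I then 0 else complex_of_real (\<alpha> n) * y (Suc n))"
  have TM: "T x \<in> ?M" if "x \<in> ?M" for x
    using that weighted_shift_l2[OF _ bounded, of x]
    by (auto simp: canonical_subspace_eq weighted_shift_def split: nat.split)
  have SM: "S y \<in> ?M" if "y \<in> ?M" for y
  proof -
    have "(\<lambda>n. of_real (if n < I then 0 else \<alpha> n) * y (Suc n)) \<in> l2"
      using that bounded order_trans[OF abs_ge_zero bounded[of 0]]
      by (intro l2_mult_bounded[where C = C] l2_shift_down) (auto simp: canonical_subspace_eq)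
    also have "(\<lambda>n. of_real (if n < I then 0 else \<alpha> n) * y (Suc n)) = S y"
      by (auto simp: S_def)
    finally show ?thesis by (simp add: canonical_subspace_eq S_def)
  qed
  have Ml2: "?M \<subseteq> l2" by (auto simp: canonical_subspace_eq)
  have inner: "l2_inner (T x) y = l2_inner x (S y)" if "x \<in> ?M" "y \<in> ?M" for x y
  proof -
    have "(\<lambda>n. T x n * cnj (y n)) sums l2_inner (T x) y"
      unfolding l2_inner_def using TM that Ml2 by (intro summable_sums l2_summable_prod) auto
    then have "(\<lambda>n. T x (Suc n) * cnj (y (Suc n))) sums l2_inner (T x) y"
      by (subst sums_Suc_iff) (simp add: weighted_shift_def)
    moreover have "T x (Suc n) * cnj (y (Suc n)) = x n * cnj (S y n)" for n
      using that(1) by (auto simp: canonical_subspace_eq S_def weighted_shift_def)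
    ultimately show ?thesis by (simp add: l2_inner_def sums_iff)
  qed
  have adj: "is_adjoint_on ?M T S"
    using TM SM inner by (auto simp: is_adjoint_on_def)
  have "(\<Sum>i\<le>k. \<Sum>j\<le>k. l2_inner ((S ^^ j) ((T ^^ i) (x j))) (x i)) \<in> \<real>\<^sub>\<ge>\<^sub>0"
    if x: "\<And>j. j \<le> k \<Longrightarrow> x j \<in> ?M" for x
  proof -
    define f where "f = (\<lambda>i j p. (T ^^ i) (x j) p * cnj ((T ^^ j) (x i) p))"
    \<comment> \<open>Grouping by \<open>q = p + k - i - j\<close> turns each block into a Hankel form of \<open>\<gamma>\<close> at \<open>q - k\<close>.\<close>
    define g where "g = (\<lambda>q i j. if q + i + j \<ge> k then f i j (q + i + j - k) else 0)"
    have g_sums: "(\<lambda>q. g q i j) sums l2_inner ((S ^^ j) ((T ^^ i) (x j))) (x i)"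
      if "i \<le> k" "j \<le> k" for i j
    proof -
      have TxM: "(T ^^ i) (x j) \<in> ?M" "(T ^^ j) (x i) \<in> ?M"
        using adjoint_power(1)[OF adj Ml2] x that by blast+
      have "f i j sums l2_inner ((T ^^ i) (x j)) ((T ^^ j) (x i))"
        unfolding f_def l2_inner_def using TxM Ml2
        by (intro summable_sums l2_summable_prod) auto
      also have "l2_inner ((T ^^ i) (x j)) ((T ^^ j) (x i)) =
          l2_inner ((S ^^ j) ((T ^^ i) (x j))) (x i)"
        using adjoint_power(2)[OF adj Ml2] x TxM that by metis
      finally have f: "f i j sums l2_inner ((S ^^ j) ((T ^^ i) (x j))) (x i)" .
      show ?thesis
      \<comment> \<open>Reindexing by \<open>d\<close> loses nothing. If
        \<open>k \<le> i + j\<close>, the skipped indices are below \<open>i + j - k\<close>, which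
        is at most \<open>i\<close> because \<open>j \<le> k\<close>, and there
        \<open>(T ^^ i) (x j)\<close> vanishes. Otherwise \<open>g\<close> merely has
        \<open>d\<close> leading zeros.\<close>
      proof (cases "k \<le> i + j")
        case True
        define d where "d = i + j - k"
        have "(\<lambda>q. f i j (q + d)) sums l2_inner ((S ^^ j) ((T ^^ i) (x j))) (x i)"
          using f by (subst sums_zero_iff_shift) (use that in \<open>auto simp: f_def shift_power d_def\<close>)
        also have "(\<lambda>q. f i j (q + d)) = (\<lambda>q. g q i j)"
          using True by (auto simp: g_def d_def add.assoc)
        finally show ?thesis .
      next
        case False
        define d where "d = k - (i + j)"
        have "(\<lambda>q. g (q + d) i j) = f i j"
          using False by (auto simp: g_def d_def)
        then show ?thesis
          using f by (subst sums_zero_iff_shift[of d, symmetric]) (use False in \<open>auto simp: g_def d_def\<close>)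
      qed
    qed
    have g_pos: "(\<Sum>i\<le>k. \<Sum>j\<le>k. g q i j) \<in> \<real>\<^sub>\<ge>\<^sub>0" for q
    proof -
      \<comment> \<open>Inverts the scaling by \<open>sqrt \<gamma>\<close> used for the test
        vectors of the converse direction; the value is \<open>0\<close> where the coordinate
        \<open>q + i - k\<close> would lie below \<open>I\<close>.\<close>
      define z where "z = (\<lambda>i. if q + i \<ge> k + I \<and> i \<le> k
        then x i (q + i - k) / of_real (sqrt (\<gamma> (q + i - k))) else 0)"
      \<comment> \<open>For \<open>q < k + I\<close> the first \<open>s\<close> components have no
        coordinate inside the subspace. The first surviving entry \<open>i = j = s\<close> then
        carries the moment index \<open>q + 2 * s - k = I + s\<close>, which is the starting point
        \<open>m\<close>. Otherwise \<open>s = 0\<close> and the block starts at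
        \<open>q - k\<close>.\<close>
      define s where "s = k + I - q"
      define m where "m = (if q \<ge> k + I then q - k else I + s)"
      have x_z: "x i (q + i - k) = of_real (sqrt (\<gamma> (q + i - k))) * z i" if "i \<le> k" "q + i \<ge> k" for i
        using \<gamma>_pos[of "q + i - k"] x[OF that(1)] that
        by (auto simp: z_def canonical_subspace_eq)
      have g_eq: "g q i j = of_real (\<gamma> (m + (i - s) + (j - s))) * z j * cnj (z i)"
        if "i \<le> k" "j \<le> k" for i j
      proof (cases "q + i \<ge> k + I \<and> q + j \<ge> k + I")
        case True
        define p where "p = q + i + j - k"
        have p: "p - i = q + j - k" "p - j = q + i - k" "i \<le> p" "j \<le> p"
          using True that by (auto simp: p_def)
        have m: "m + (i - s) + (j - s) = p"
          using True by (auto simp: m_def s_def p_def)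
        have Tx: "(T ^^ i) (x j) p = of_real (sqrt (\<gamma> p)) * z j"
          "(T ^^ j) (x i) p = of_real (sqrt (\<gamma> p)) * z i"
          using p x_z True that \<gamma>_pos[of "q + j - k"] \<gamma>_pos[of "q + i - k"]
          by (auto simp: shift_power real_sqrt_divide)
        have "g q i j = f i j p" using True by (auto simp: g_def p_def)
        also have "\<dots> = (of_real (sqrt (\<gamma> p)))\<^sup>2 * z j * cnj (z i)"
          by (simp add: f_def Tx power2_eq_square mult_ac)
        also have "(of_real (sqrt (\<gamma> p)))\<^sup>2 = complex_of_real (\<gamma> p)"
          using \<gamma>_pos[of p] by (simp flip: of_real_power)
        finally show ?thesis by (simp add: m)
      next
        case False
        then have "f i j (q + i + j - k) = 0" if "q + i + j \<ge> k"
          using that x[OF \<open>i \<le> k\<close>] x[OF \<open>j \<le> k\<close>]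
          by (auto simp: f_def shift_power canonical_subspace_eq)
        then show ?thesis using False by (auto simp: g_def z_def)
      qed
      have "(\<Sum>i\<le>k. \<Sum>j\<le>k. g q i j) =
          hankel_form \<gamma> k m (\<lambda>i. if i + s \<le> k then z (i + s) else 0)"
        by (subst hankel_form_shift[symmetric]) (auto simp: g_eq z_def s_def)
      moreover have "m \<ge> I" by (auto simp: m_def)
      ultimately show ?thesis using psd by simp
    qed
    have "(\<lambda>q. \<Sum>i\<le>k. \<Sum>j\<le>k. g q i j) sums
        (\<Sum>i\<le>k. \<Sum>j\<le>k. l2_inner ((S ^^ j) ((T ^^ i) (x j))) (x i))"
      using g_sums by (intro sums_sum) auto
    then have "(\<Sum>i\<le>k. \<Sum>j\<le>k. l2_inner ((S ^^ j) ((T ^^ i) (x j))) (x i)) =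
        (\<Sum>q. \<Sum>i\<le>k. \<Sum>j\<le>k. g q i j)"
      and "summable (\<lambda>q. \<Sum>i\<le>k. \<Sum>j\<le>k. g q i j)"
      by (simp_all only: sums_iff)
    then show ?thesis
      using nonneg_Reals_suminf[OF _ g_pos] by simp
  qed
  then show ?thesis using adj unfolding k_hyponormal_on_def by blast
qed

end

section \<open>Hankel forms of atomic moment sequences\<close>

text \<open>Lagrange interpolation writes \<open>p\<close> as a combination of fixed polynomials
  with the values of \<open>p\<close> on \<open>A\<close> as coefficients. These polynomials are
  bounded on the disc of radius \<open>R\<close>, so the constant depends on \<open>A\<close> and
  \<open>R\<close> only.\<close>

lemma poly_bounded_by_values:
  fixes A :: "complex set"
  assumes "finite A"
  obtains C where "C \<ge> 0"
    "\<And>p t. degree p < card A \<Longrightarrow> cmod t \<le> R \<Longrightarrow>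
       (cmod (poly p t))\<^sup>2 \<le> C * (\<Sum>x\<in>A. (cmod (poly p x))\<^sup>2)"
proof -
  define L where "L = (\<lambda>x. smult (inverse (\<Prod>y\<in>A-{x}. x - y)) (\<Prod>y\<in>A-{x}. [:- y, 1:]))"
  have L_eval: "poly (L x) t = (if t = x then 1 else 0)" if "x \<in> A" "t \<in> A" for x t
    using that assms by (auto simp: L_def poly_prod)
  have L_degree: "degree (L x) < card A" if "x \<in> A" for x
  proof -
    have "degree (L x) \<le> sum (degree \<circ> (\<lambda>y. [:- y, 1:])) (A - {x})"
      unfolding L_def using assms by (intro order.trans[OF degree_smult_le] degree_prod_sum_le) auto
    also have "\<dots> < card A" using assms that card_gt_0_iff[of A] by auto
    finally show ?thesis .
  qed
  have "\<exists>B. \<forall>t\<in>cball 0 R. cmod (poly (L x) t) \<le> B" for x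
  proof -
    have "compact (poly (L x) ` cball 0 R)"
      by (intro compact_continuous_image continuous_intros) auto
    then show ?thesis using compact_imp_bounded bounded_iff by (metis imageI)
  qed
  then obtain B where B: "\<And>x t. cmod t \<le> R \<Longrightarrow> cmod (poly (L x) t) \<le> B x"
    by (metis dist_0_norm mem_cball)
  define K where "K = (\<Sum>x\<in>A. \<bar>B x\<bar>)"
  have "K \<ge> 0" by (simp add: K_def sum_nonneg)
  have BK: "cmod (poly (L x) t) \<le> K" if "x \<in> A" "cmod t \<le> R" for x t
    using B[OF that(2), of x] member_le_sum[of x A "\<lambda>x. \<bar>B x\<bar>"] assms that by (simp add: K_def)
  show ?thesis
  proof (rule that[of "K\<^sup>2 * card A"])
    fix p :: "complex poly" and t :: complex
    assume p: "degree p < card A" and t: "cmod t \<le> R"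
    have "p = (\<Sum>x\<in>A. smult (poly p x) (L x))"
    proof (rule poly_eqI_degree[of A])
      show "degree (\<Sum>x\<in>A. smult (poly p x) (L x)) < card A"
        using p by (intro degree_sum_less le_less_trans[OF degree_smult_le] L_degree) auto
      fix t assume "t \<in> A"
      then have "poly (\<Sum>x\<in>A. smult (poly p x) (L x)) t = (\<Sum>x\<in>A. if t = x then poly p x else 0)"
        unfolding poly_sum by (intro sum.cong) (auto simp: L_eval)
      then show "poly p t = poly (\<Sum>x\<in>A. smult (poly p x) (L x)) t"
        using \<open>t \<in> A\<close> assms by simp
    qed (fact p)
    then have "poly p t = (\<Sum>x\<in>A. poly p x * poly (L x) t)"
      by (metis (no_types, lifting) poly_smult poly_sum sum.cong)
    also have "cmod \<dots> \<le> (\<Sum>x\<in>A. cmod (poly p x) * K)"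
      using BK t by (intro sum_norm_le) (simp add: norm_mult mult_left_mono)
    finally have "(cmod (poly p t))\<^sup>2 \<le> (\<Sum>x\<in>A. cmod (poly p x) * K)\<^sup>2"
      by (intro power_mono) auto
    \<comment> \<open>Cauchy-Schwarz against the constant vector \<open>1\<close>, which produces
      the factor \<open>card A\<close>.\<close>
    also have "\<dots> \<le> (\<Sum>x\<in>A. (cmod (poly p x) * K)\<^sup>2) * card A"
      by (rule sum_squared_le_sum_of_squares)
    also have "\<dots> = K\<^sup>2 * card A * (\<Sum>x\<in>A. (cmod (poly p x))\<^sup>2)"
      by (simp add: power_mult_distrib sum_distrib_left sum_distrib_right mult_ac)
    finally show "(cmod (poly p t))\<^sup>2 \<le> K\<^sup>2 * card A * (\<Sum>x\<in>A. (cmod (poly p x))\<^sup>2)" .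
  qed simp
qed

section \<open>Integrals against the positive part as series\<close>

lemma integral_atomic_pos_part:
  assumes "summable (\<lambda>i. \<bar>a i\<bar> * r i ^ n)" "\<And>i. r i > 0"
  shows "(LINT t:{0..}|atomic_pos_part a r. t ^ n) = (\<Sum>i. max 0 (a i) * r i ^ n)"
proof -
  have "summable (\<lambda>i. norm (max 0 (a i) * r i ^ n))"
  proof (rule summable_comparison_test[OF _ assms(1)], intro exI allI impI)
    fix i
    show "norm (norm (max 0 (a i) * r i ^ n)) \<le> \<bar>a i\<bar> * r i ^ n"
      using assms(2)[of i] by (auto simp: abs_mult intro!: mult_right_mono)
  qed
  then have int: "integrable (count_space UNIV) (\<lambda>i. max 0 (a i) * r i ^ n)"
    by (simp add: integrable_count_space_nat_iff)
  \<comment> \<open>\<open>ennreal\<close> already truncates negative masses; making this explicit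
    gives the nonnegative real density that the integral formula requires.\<close>
  have dens: "density (count_space UNIV) (\<lambda>i. ennreal (a i)) =
      density (count_space UNIV) (\<lambda>i. ennreal (max 0 (a i)))"
    by (intro arg_cong[where f = "density _"] ext) (auto simp: max_def ennreal_neg)
  have "(LINT t:{0..}|atomic_pos_part a r. t ^ n) =
     (LINT i|density (count_space UNIV) (\<lambda>i. ennreal (max 0 (a i))). indicator {0..} (r i) *\<^sub>R r i ^ n)"
    unfolding set_lebesgue_integral_def atomic_pos_part_def dens
    by (rule integral_distr) auto
  also have "\<dots> = (LINT i|count_space UNIV. max 0 (a i) *\<^sub>R (indicator {0..} (r i) *\<^sub>R r i ^ n))"
    by (rule integral_density) auto
  also have "\<dots> = (LINT i|count_space UNIV. max 0 (a i) * r i ^ n)"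
    using assms(2) by (simp add: less_imp_le)
  also have "\<dots> = (\<Sum>i. max 0 (a i) * r i ^ n)"
    by (rule integral_count_space_nat[OF int])
  finally show ?thesis .
qed

section \<open>Geometric domination of later atoms by earlier ones\<close>

locale atomic_sequence =
  fixes a r :: "nat \<Rightarrow> real"
  assumes summable_a: "summable (\<lambda>i. \<bar>a i\<bar>)"
    and r_pos: "r i > 0"
    and r_Suc_less: "r (Suc i) < r i"
begin

lemma r_antimono: "i \<le> j \<Longrightarrow> r j \<le> r i"
  using lift_Suc_antimono_le[of r] r_Suc_less less_imp_le by metis

lemma r_strict: "i < j \<Longrightarrow> r j < r i"
  using r_antimono[of "Suc i" j] r_Suc_less[of i] by simp

lemma inj_r: "inj r"
  by (metis injI r_strict linorder_neqE_nat less_irrefl)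

text \<open>The factor \<open>b\<close> stands for a value of a bounded function at an atom: later
  either the constant \<open>1\<close>, giving moments, or the squared modulus of a polynomial,
  giving Hankel forms.\<close>

lemma weighted_bound:
  assumes "\<bar>b\<bar> \<le> B" "j \<le> i"
  shows "norm (a i * r i ^ m * b) \<le> B * r j ^ m * \<bar>a i\<bar>"
proof -
  have "r i ^ m \<le> r j ^ m" using r_pos less_imp_le assms(2) r_antimono by (intro power_mono) auto
  then have "r i ^ m * \<bar>b\<bar> \<le> r j ^ m * B"
    using assms(1) r_pos[of j] by (intro mult_mono) auto
  then have "\<bar>a i\<bar> * (r i ^ m * \<bar>b\<bar>) \<le> \<bar>a i\<bar> * (r j ^ m * B)"
    by (intro mult_left_mono) auto
  then show ?thesis using r_pos[of i] by (simp add: abs_mult mult_ac)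
qed

lemma summable_weighted:
  assumes "\<And>i. \<bar>b i\<bar> \<le> B"
  shows "summable (\<lambda>i. a i * r i ^ m * b i)"
proof (rule summable_comparison_test)
  show "summable (\<lambda>i. B * r 0 ^ m * \<bar>a i\<bar>)" by (intro summable_mult summable_a)
qed (use weighted_bound[OF assms, of 0] in auto)

text \<open>All atoms after the index \<open>j\<close> lie at or below \<open>r (Suc j)\<close>, so
  their total contribution is controlled by one power and the total mass.\<close>

lemma suminf_weighted_split:
  assumes "\<And>i. \<bar>b i\<bar> \<le> B"
  shows "\<bar>(\<Sum>i. a i * r i ^ m * b i) - (\<Sum>i\<le>j. a i * r i ^ m * b i)\<bar>
    \<le> B * r (Suc j) ^ m * (\<Sum>i. \<bar>a i\<bar>)"
proof -
  let ?f = "\<lambda>i. a i * r i ^ m * b i"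
  have "B \<ge> 0" using assms[of 0] by simp
  have sa: "summable (\<lambda>i. \<bar>a (i + Suc j)\<bar>)"
    using summable_a summable_iff_shift[of "\<lambda>i. \<bar>a i\<bar>" "Suc j"] by blast
  have "suminf ?f = (\<Sum>i. ?f (i + Suc j)) + (\<Sum>i\<le>j. ?f i)"
    using suminf_split_initial_segment[OF summable_weighted[of b B m, OF assms], of "Suc j"]
    by (simp add: lessThan_Suc_atMost)
  then have "\<bar>suminf ?f - (\<Sum>i\<le>j. ?f i)\<bar> = norm (\<Sum>i. ?f (i + Suc j))"
    by simp
  also have "\<dots> \<le> (\<Sum>i. B * r (Suc j) ^ m * \<bar>a (i + Suc j)\<bar>)"
    using sa weighted_bound[OF assms] by (intro suminf_le norm_suminf_le summable_mult) auto
  also have "\<dots> = B * r (Suc j) ^ m * (\<Sum>i. \<bar>a (i + Suc j)\<bar>)"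
    by (rule suminf_mult[OF sa])
  also have "\<dots> \<le> B * r (Suc j) ^ m * (\<Sum>i. \<bar>a i\<bar>)"
  proof (intro mult_left_mono)
    show "(\<Sum>i. \<bar>a (i + Suc j)\<bar>) \<le> (\<Sum>i. \<bar>a i\<bar>)"
      using suminf_split_initial_segment[OF summable_a, of "Suc j"]
        sum_nonneg[of "{..<Suc j}" "\<lambda>i. \<bar>a i\<bar>"] by simp
  qed (use \<open>B \<ge> 0\<close> r_pos[of "Suc j"] in auto)
  finally show ?thesis .
qed

text \<open>The ratio \<open>r (Suc j) / r j\<close> lies strictly between \<open>0\<close> and
  \<open>1\<close>, so its powers tend to \<open>0\<close> and beat any constant.\<close>

lemma eventually_tail_small:
  assumes "\<epsilon> > 0"
  shows "eventually (\<lambda>m. K * r (Suc j) ^ m \<le> \<epsilon> * r j ^ m) sequentially"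
proof -
  have "(\<lambda>m. K * (r (Suc j) / r j) ^ m) \<longlonglongrightarrow> K * 0"
    using r_pos r_Suc_less by (intro tendsto_intros LIMSEQ_power_zero) (simp add: less_imp_le abs_of_pos)
  then have "eventually (\<lambda>m. K * (r (Suc j) / r j) ^ m < \<epsilon>) sequentially"
    using assms by (intro order_tendstoD) auto
  then show ?thesis
  proof eventually_elim
    case (elim m)
    then show ?case using r_pos[of j] by (simp add: power_divide field_simps)
  qed
qed

definition moment :: "nat \<Rightarrow> real" where
  "moment n = (\<Sum>i. a i * r i ^ n)"

lemma sums_moment: "(\<lambda>i. a i * r i ^ n) sums moment n"
  using summable_weighted[of "\<lambda>_. 1" 1 n] by (simp add: moment_def summable_sums)

text \<open>Both integrals are absolutely convergent series, and
  \<open>max 0 (a i) - max 0 (- a i) = a i\<close> recombines them term by term.\<close>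

lemma signed_atomic_moment_eq: "signed_atomic_moment a r n = moment n"
proof -
  have "summable (\<lambda>i. \<bar>a i\<bar> * r i ^ n)"
  proof (rule summable_comparison_test)
    show "summable (\<lambda>i. 1 * r 0 ^ n * \<bar>a i\<bar>)" by (intro summable_mult summable_a)
  qed (use weighted_bound[of 1 1 0 _ n] in \<open>auto simp: abs_mult\<close>)
  note s = this
  have pos: "summable (\<lambda>i. max 0 (c i) * r i ^ n)" if "\<And>i. \<bar>c i\<bar> = \<bar>a i\<bar>" for c
  proof (rule summable_comparison_test[OF _ s], intro exI allI impI)
    fix i
    show "norm (max 0 (c i) * r i ^ n) \<le> \<bar>a i\<bar> * r i ^ n"
      using r_pos[of i] that[of i] by (auto simp: abs_mult intro!: mult_right_mono)
  qed
  have "signed_atomic_moment a r n =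
      (\<Sum>i. max 0 (a i) * r i ^ n) - (\<Sum>i. max 0 (- a i) * r i ^ n)"
    unfolding signed_atomic_moment_def atomic_neg_part_def using s r_pos
    by (simp add: integral_atomic_pos_part)
  also have "\<dots> = (\<Sum>i. max 0 (a i) * r i ^ n - max 0 (- a i) * r i ^ n)"
    by (intro suminf_diff pos) auto
  also have "\<dots> = moment n"
    unfolding moment_def by (intro suminf_cong) (auto simp: max_def)
  finally show ?thesis .
qed

section \<open>Hankel forms as weighted sums of polynomial values\<close>

abbreviation sq_eval :: "complex poly \<Rightarrow> nat \<Rightarrow> real" where
  "sq_eval p i \<equiv> (cmod (poly p (of_real (r i))))\<^sup>2"

lemma sq_eval_bounded: obtains B where "\<And>i. \<bar>sq_eval p i\<bar> \<le> B"
proof -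
  have "compact (poly p ` cball 0 (r 0))"
    by (intro compact_continuous_image continuous_intros) auto
  then obtain B where B: "\<And>t. cmod t \<le> r 0 \<Longrightarrow> cmod (poly p t) \<le> B"
    using compact_imp_bounded bounded_iff by (metis dist_0_norm imageI mem_cball)
  have "\<bar>sq_eval p i\<bar> \<le> B\<^sup>2" for i
    using B[of "of_real (r i)"] r_pos[of i] r_antimono[of 0 i] by (simp add: power_mono)
  then show ?thesis by (rule that)
qed

text \<open>Each atom contributes a rank-one form: the factor \<open>r l ^ (i + j)\<close> splits
  between the two coefficient vectors, and the double sum becomes \<open>poly p\<close> at
  \<open>r l\<close> times its conjugate.\<close>

lemma hankel_form_moment:
  assumes "degree p \<le> k"
  shows "hankel_form moment k m (coeff p) = of_real (\<Sum>l. a l * r l ^ m * sq_eval p l)"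
proof -
  have "(\<lambda>l. \<Sum>i\<le>k. \<Sum>j\<le>k. of_real (a l * r l ^ (m + i + j)) * coeff p j * cnj (coeff p i))
      sums hankel_form moment k m (coeff p)"
    unfolding hankel_form_def
    by (intro sums_sum sums_mult2 sums_of_real sums_moment)
  moreover have "(\<Sum>i\<le>k. \<Sum>j\<le>k. of_real (a l * r l ^ (m + i + j)) * coeff p j * cnj (coeff p i)) =
      complex_of_real (a l * r l ^ m * sq_eval p l)" for l
  proof -
    have "poly p (of_real (r l)) = (\<Sum>j\<le>k. coeff p j * of_real (r l) ^ j)"
      by (subst (1) poly_as_sum_of_monoms'[OF assms, symmetric]) (simp add: poly_sum poly_monom)
    then have "of_real (sq_eval p l) =
        (\<Sum>j\<le>k. coeff p j * of_real (r l) ^ j) * (\<Sum>i\<le>k. cnj (coeff p i) * of_real (r l) ^ i)"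
      by (simp only: complex_norm_square) simp
    also have "\<dots> = (\<Sum>i\<le>k. \<Sum>j\<le>k. coeff p j * of_real (r l) ^ j * (cnj (coeff p i) * of_real (r l) ^ i))"
      unfolding sum_product by (rule sum.swap)
    finally show ?thesis
      by (simp add: sum_distrib_left power_add mult_ac)
  qed
  moreover obtain B where "\<And>i. \<bar>sq_eval p i\<bar> \<le> B" using sq_eval_bounded by blast
  then have "(\<lambda>l. complex_of_real (a l * r l ^ m * sq_eval p l)) sums
      of_real (\<Sum>l. a l * r l ^ m * sq_eval p l)"
    by (intro sums_of_real summable_sums summable_weighted)
  ultimately show ?thesis using sums_unique2 by force
qed

text \<open>Supplies the boundedness of the weights, hence of the shift. Eventually the first atom
  carries at least half of its own contribution to the denominator, while the numerator is at most
  \<open>(a 0 + A) * r 0 ^ Suc n\<close>; the constant is the quotient of these bounds.\<close>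

lemma moment_ratio_bounded:
  assumes "a 0 > 0"
  obtains C where "\<And>n. \<bar>moment (Suc n) / moment n\<bar> \<le> C"
proof -
  define A where "A = (\<Sum>i. \<bar>a i\<bar>)"
  have upper: "\<bar>moment n - a 0 * r 0 ^ n\<bar> \<le> A * r (Suc 0) ^ n" for n
    using suminf_weighted_split[of "\<lambda>_. 1" 1 n 0] by (simp add: moment_def A_def mult_ac)
  have "A \<ge> 0" unfolding A_def by (intro suminf_nonneg summable_a) auto
  have "eventually (\<lambda>n. \<bar>moment (Suc n) / moment n\<bar> \<le> 2 * (a 0 + A) * r 0 / a 0) sequentially"
    using eventually_tail_small[OF half_gt_zero[OF assms], of A 0]
  proof eventually_elim
    case (elim n)
    have pos: "r 0 ^ n > 0" using r_pos by simp
    have "r (Suc 0) ^ Suc n \<le> r 0 ^ Suc n"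
      using r_antimono[of 0 1] r_pos[of "Suc 0"] by (intro power_mono) auto
    then have "A * r (Suc 0) ^ Suc n \<le> A * r 0 ^ Suc n" using \<open>A \<ge> 0\<close> by (intro mult_left_mono)
    then have "\<bar>moment (Suc n)\<bar> \<le> (a 0 + A) * r 0 ^ Suc n"
      using upper[of "Suc n"] assms r_pos[of 0] by (simp add: algebra_simps abs_le_iff)
        (smt (verit) mult_nonneg_nonneg zero_le_power)
    moreover have low: "moment n \<ge> a 0 / 2 * r 0 ^ n"
      using upper[of n] elim by (simp add: abs_le_iff)
    moreover have "a 0 / 2 * r 0 ^ n > 0" using pos assms by simp
    ultimately have "\<bar>moment (Suc n)\<bar> / moment n \<le> (a 0 + A) * r 0 ^ Suc n / (a 0 / 2 * r 0 ^ n)"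
      using pos by (intro frac_le) auto
    also have "\<dots> = 2 * (a 0 + A) * r 0 / a 0" using r_pos[of 0] assms by (simp add: field_simps)
    finally show ?case using low \<open>a 0 / 2 * r 0 ^ n > 0\<close> by simp
  qed
  \<comment> \<open>The finitely many exceptional \<open>n\<close> only enlarge the
    constant.\<close>
  then have "Bseq (\<lambda>n. moment (Suc n) / moment n)"
    by (intro BfunI[of _ "2 * (a 0 + A) * r 0 / a 0"]) simp
  then show ?thesis using that unfolding Bseq_def by auto
qed

text \<open>Apart from the case without negative masses, \<open>A\<close> collects the indices of
  the first \<open>k + 1\<close> non-zero masses, the last of which is \<open>j\<close>.
  Interpolation at \<open>A\<close> bounds the tail after \<open>j\<close> by a multiple of the sum
  \<open>E\<close> of the values on \<open>A\<close>, and \<open>A\<close> itself contributes at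
  least \<open>\<delta> * r j ^ m * E\<close>.\<close>

lemma eventually_psd:
  assumes pos: "\<And>i. a i \<noteq> 0 \<Longrightarrow> card {j. j < i \<and> a j \<noteq> 0} < k + 1 \<Longrightarrow> a i > 0"
  shows "\<exists>I. \<forall>m\<ge>I. \<forall>p. degree p \<le> k \<longrightarrow> (\<Sum>l. a l * r l ^ m * sq_eval p l) \<ge> 0"
proof (cases "\<forall>i. a i \<ge> 0")
  case True
  have "(\<Sum>l. a l * r l ^ m * sq_eval p l) \<ge> 0" for m p
  proof -
    obtain B where "\<And>i. \<bar>sq_eval p i\<bar> \<le> B" using sq_eval_bounded by blast
    then show ?thesis
      using True less_imp_le[OF r_pos]
      by (intro suminf_nonneg summable_weighted mult_nonneg_nonneg zero_le_power) auto
  qed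
  then show ?thesis by blast
next
  case False
  then obtain n where n: "a n < 0" by (auto simp: not_le)
  define N where "N = (\<lambda>i. {j. j < i \<and> a j \<noteq> 0})"
  have fin: "finite (N i)" for i by (simp add: N_def)
  have N_mono: "i \<le> j \<Longrightarrow> card (N i) \<le> card (N j)" for i j
    using fin by (intro card_mono) (auto simp: N_def)
  have "card (N n) \<ge> k + 1" using pos[of n] n by (force simp: N_def)
  \<comment> \<open>The count of non-zero masses starts at \<open>0\<close> and reaches
    \<open>k + 1\<close> by the negative mass at \<open>n\<close>; \<open>j\<close> is where it
    crosses that value.\<close>
  then obtain j where j: "card (N j) < k + 1" "card (N (Suc j)) \<ge> k + 1"
    using ex_least_nat_less[of "\<lambda>i. card (N i) \<ge> k + 1" n] by (auto simp: N_def not_le)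
  define A where "A = N (Suc j)"
  have "N (Suc j) \<subseteq> insert j (N j)" by (auto simp: N_def less_Suc_eq)
  then have "card A \<le> Suc (card (N j))"
    unfolding A_def using card_mono[of "insert j (N j)"] card_insert_le_m1 fin
    by (metis card_insert_if finite_insert le_SucI order_trans order_refl)
  then have cardA: "card A = k + 1" using j by (simp add: A_def)
  have "finite A" "A \<noteq> {}" using fin cardA by (auto simp: A_def)
  have posA: "a i > 0" "i \<le> j" if "i \<in> A" for i
    using that pos[of i] N_mono[of i j] j(1) by (auto simp: A_def N_def)
  define \<delta> where "\<delta> = Min (a ` A)"
  have \<delta>: "\<delta> > 0" "\<And>i. i \<in> A \<Longrightarrow> \<delta> \<le> a i"
    using \<open>finite A\<close> \<open>A \<noteq> {}\<close> posA by (auto simp: \<delta>_def)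
  define pt where "pt = (\<lambda>i. complex_of_real (r i))"
  have inj: "inj_on pt A" using inj_r by (auto simp: pt_def inj_on_def)
  obtain C where C: "C \<ge> 0" "\<And>p t. degree p < card (pt ` A) \<Longrightarrow> cmod t \<le> r 0 \<Longrightarrow>
       (cmod (poly p t))\<^sup>2 \<le> C * (\<Sum>x\<in>pt ` A. (cmod (poly p x))\<^sup>2)"
    using poly_bounded_by_values[of "pt ` A" "r 0"] \<open>finite A\<close> by blast
  \<comment> \<open>The threshold is fixed before any polynomial is chosen, so it serves all of them
    at once.\<close>
  obtain I where I: "\<And>m. m \<ge> I \<Longrightarrow> C * (\<Sum>i. \<bar>a i\<bar>) * r (Suc j) ^ m \<le> \<delta> * r j ^ m"
    using eventually_tail_small[OF \<delta>(1)] unfolding eventually_sequentially by meson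
  have "(\<Sum>l. a l * r l ^ m * sq_eval p l) \<ge> 0" if "m \<ge> I" "degree p \<le> k" for m p
  proof -
    define E where "E = (\<Sum>i\<in>A. sq_eval p i)"
    have "E \<ge> 0" by (simp add: E_def sum_nonneg)
    have "\<bar>sq_eval p i\<bar> \<le> C * E" for i
      using C(2)[of p "pt i"] that(2) cardA inj r_pos[of i] r_antimono[of 0 i]
      by (simp add: card_image sum.reindex E_def pt_def)
    then have "\<bar>(\<Sum>l. a l * r l ^ m * sq_eval p l) - (\<Sum>l\<le>j. a l * r l ^ m * sq_eval p l)\<bar>
        \<le> C * E * r (Suc j) ^ m * (\<Sum>i. \<bar>a i\<bar>)"
      by (rule suminf_weighted_split)
    also have "\<dots> = C * (\<Sum>i. \<bar>a i\<bar>) * r (Suc j) ^ m * E" by (simp add: mult_ac)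
    also have "\<dots> \<le> \<delta> * r j ^ m * E"
      using I[OF that(1)] \<open>E \<ge> 0\<close> by (rule mult_right_mono)
    also have "\<dots> = (\<Sum>l\<in>A. \<delta> * r j ^ m * sq_eval p l)" by (simp add: E_def sum_distrib_left)
    also have "\<dots> \<le> (\<Sum>l\<in>A. a l * r l ^ m * sq_eval p l)"
    proof (intro sum_mono mult_right_mono mult_mono)
      fix i assume "i \<in> A"
      then show "\<delta> \<le> a i" "0 \<le> a i" "r j ^ m \<le> r i ^ m"
        using \<delta> posA[of i] r_antimono[of i j] r_pos[of j] by (auto intro: power_mono)
    qed (use r_pos[of j] in auto)
    \<comment> \<open>Every index up to \<open>j\<close> outside \<open>A\<close> has mass
      zero.\<close>
    also have "\<dots> = (\<Sum>l\<le>j. a l * r l ^ m * sq_eval p l)"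
      by (intro sum.mono_neutral_left) (auto simp: A_def N_def)
    finally show ?thesis by linarith
  qed
  then show ?thesis by blast
qed

text \<open>The polynomial with simple roots at the earlier atoms of non-zero mass has degree at
  most \<open>k\<close>, and it does not vanish at \<open>r i\<close> because the atoms are
  distinct. The negative term at \<open>i\<close> is therefore the leading one.\<close>

lemma eventually_not_psd:
  assumes "a i < 0" "card {j. j < i \<and> a j \<noteq> 0} \<le> k"
  obtains p where "degree p \<le> k"
    "eventually (\<lambda>m. (\<Sum>l. a l * r l ^ m * sq_eval p l) < 0) sequentially"
proof
  define p where "p = (\<Prod>j | j < i \<and> a j \<noteq> 0. [:- complex_of_real (r j), 1:])"
  have "degree p \<le> (\<Sum>j | j < i \<and> a j \<noteq> 0. 1)"
    unfolding p_def by (rule order.trans[OF degree_prod_sum_le]) auto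
  then show "degree p \<le> k" using assms(2) by simp
  obtain B where B: "\<And>l. \<bar>sq_eval p l\<bar> \<le> B" using sq_eval_bounded by blast
  have zero: "a l * r l ^ m * sq_eval p l = 0" if "l < i" for l m
    using that by (auto simp: p_def poly_prod intro!: prod_zero)
  have "sq_eval p i > 0"
    using inj_r by (auto simp: p_def poly_prod inj_eq)
  \<comment> \<open>Letting the tail use up only half of the negative term leaves the other half to
    keep the sum negative.\<close>
  then have "- a i * sq_eval p i / 2 > 0" using assms(1) by (simp add: mult_neg_pos)
  from eventually_tail_small[OF this, of "B * (\<Sum>l. \<bar>a l\<bar>)" i]
  show "eventually (\<lambda>m. (\<Sum>l. a l * r l ^ m * sq_eval p l) < 0) sequentially"
  proof eventually_elim
    case (elim m)
    have "(\<Sum>l\<le>i. a l * r l ^ m * sq_eval p l) = (\<Sum>l\<in>{i}. a l * r l ^ m * sq_eval p l)"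
      using zero by (intro sum.mono_neutral_right) auto
    then have "\<bar>(\<Sum>l. a l * r l ^ m * sq_eval p l) - a i * r i ^ m * sq_eval p i\<bar>
        \<le> B * (\<Sum>l. \<bar>a l\<bar>) * r (Suc i) ^ m"
      using suminf_weighted_split[of "sq_eval p" B m i, OF B] by (simp add: mult_ac)
    also note elim
    finally have "(\<Sum>l. a l * r l ^ m * sq_eval p l) \<le> (a i * sq_eval p i) * r i ^ m / 2"
      by (simp add: abs_le_iff algebra_simps)
    also have "\<dots> < 0"
      using assms(1) \<open>sq_eval p i > 0\<close> r_pos[of i] by (simp add: mult_neg_pos)
    finally show ?case .
  qed
qed

end

theorem theorem3p5:
  fixes a r \<gamma> \<alpha> :: "nat \<Rightarrow> real" and k :: nat
  assumes "summable (\<lambda>i. \<bar>a i\<bar>)"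
    and "a 0 > 0"
    and "\<And>i. r i > 0"
    and "\<And>i. r (Suc i) < r i"
    and "(\<Sum>i. a i) = 1"
    and "\<And>n. \<gamma> n = signed_atomic_moment a r n"
    and "\<And>n. \<gamma> n > 0"
    and "\<And>n. \<alpha> n = sqrt (\<gamma> (Suc n) / \<gamma> n)"
    and "k \<ge> 1"
  shows "(\<exists>I. k_hyponormal_on k (canonical_subspace I) (weighted_shift \<alpha>)) \<longleftrightarrow>
         (\<forall>i. a i \<noteq> 0 \<and> card {j. j < i \<and> a j \<noteq> 0} < k + 1 \<longrightarrow> a i > 0)"
proof
  interpret atomic_sequence a r by standard (use assms in auto)
  interpret moment_shift \<gamma> \<alpha> by standard (use assms in auto)
  have \<gamma>: "\<gamma> = moment" using assms(6) by (auto simp: signed_atomic_moment_eq)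
  {
    assume "\<exists>I. k_hyponormal_on k (canonical_subspace I) (weighted_shift \<alpha>)"
    then obtain I where I: "k_hyponormal_on k (canonical_subspace I) (weighted_shift \<alpha>)" ..
    show "\<forall>i. a i \<noteq> 0 \<and> card {j. j < i \<and> a j \<noteq> 0} < k + 1 \<longrightarrow> a i > 0"
    proof (intro allI impI, elim conjE, rule ccontr)
      fix i assume "a i \<noteq> 0" "card {j. j < i \<and> a j \<noteq> 0} < k + 1" "\<not> a i > 0"
      then obtain p where p: "degree p \<le> k"
        "eventually (\<lambda>m. (\<Sum>l. a l * r l ^ m * sq_eval p l) < 0) sequentially"
        using eventually_not_psd[of i k] by force
      then obtain M where "\<And>m. m \<ge> M \<Longrightarrow> (\<Sum>l. a l * r l ^ m * sq_eval p l) < 0"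
        by (auto simp: eventually_sequentially)
      \<comment> \<open>The index \<open>max I M\<close> is both admissible for the restricted shift
        and late enough for the sum to be negative.\<close>
      then have "(\<Sum>l. a l * r l ^ max I M * sq_eval p l) < 0" by simp
      moreover have "hankel_form \<gamma> k (max I M) (coeff p) \<in> \<real>\<^sub>\<ge>\<^sub>0"
        by (rule hankel_of_k_hyponormal[OF I]) simp
      ultimately show False
        by (simp add: \<gamma> hankel_form_moment[OF p(1)])
    qed
  next
    assume "\<forall>i. a i \<noteq> 0 \<and> card {j. j < i \<and> a j \<noteq> 0} < k + 1 \<longrightarrow> a i > 0"
    then obtain I where
      I: "\<And>m p. m \<ge> I \<Longrightarrow> degree p \<le> k \<Longrightarrow> (\<Sum>l. a l * r l ^ m * sq_eval p l) \<ge> 0"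
      using eventually_psd[of k] by blast
    obtain C where "\<And>n. \<bar>\<gamma> (Suc n) / \<gamma> n\<bar> \<le> C"
      using moment_ratio_bounded[OF assms(2)] unfolding \<gamma> by blast
    \<comment> \<open>A bound on the moment ratios gives \<open>sqrt C\<close> for the weights, so
      the shift maps \<open>l2\<close> into itself.\<close>
    then have "\<gamma> (Suc n) / \<gamma> n \<le> C" for n
      using order_trans[OF abs_ge_self] by blast
    then have "\<bar>\<alpha> n\<bar> \<le> sqrt C" for n
      using \<gamma>_pos[of n] \<gamma>_pos[of "Suc n"] by (simp add: \<alpha>_eq)
    moreover have "hankel_form \<gamma> k m z \<in> \<real>\<^sub>\<ge>\<^sub>0" if "m \<ge> I" for m z
    proof -
      obtain p where p: "degree p \<le> k" and eq: "hankel_form \<gamma> k m z = hankel_form \<gamma> k m (coeff p)"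
        using hankel_form_eq_coeff by blast
      show ?thesis
        unfolding eq unfolding \<gamma> hankel_form_moment[OF p] using I[OF that p] by simp
    qed
    ultimately have "k_hyponormal_on k (canonical_subspace I) (weighted_shift \<alpha>)"
      by (rule k_hyponormal_of_hankel)
    then show "\<exists>I. k_hyponormal_on k (canonical_subspace I) (weighted_shift \<alpha>)" ..
  }
qed

end
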